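(* Let $n\ge 1$ and $s\ge 2$ be integers, let $Z=\{z_1,\dots,z_s\}\subset B_2^n\subset\mathbb{R}^n$ be a set of $s$ distinct points, and let $N\ge s-1$ be an integer. Then the smallest singular value $\sigma_s(V_N(Z))$ of the $s\times\nu$ matrix $V_N(Z)$ satisfies $$\sigma_s(V_N(Z))\ge\frac{\kappa(Z)^{s-1}}{(4n)^{s-1}\,s\,\sqrt{s\,\nu}}.$$
   Context: $B_2^n=\{x\in\mathbb{R}^n:\|x\|_2\le 1\}$. $\nu=\nu(n,N)=\binom{N+n}{N}$ is the number of monomials $z^\alpha=\prod_\ell z_\ell^{\alpha_\ell}$ in $n$ variables with $\alpha\in\mathbb{Z}_{\ge0}^n$, $|\alpha|=\sum_\ell\alpha_\ell\le N$. $V_N(Z)\in\mathbb{R}^{s\times\nu}$ is the matrix whose $i$-th row is $V_N(z_i)=(z_i^\alpha)_{|\alpha|\le N}$ (in a fixed ordering of the multi-indices, with $0^0=1$). $\sigma_s$ denotes the $s$-th largest singular value. The projection separations are $\rho(Z,j)=\max_{\|v\|_2=1}\min_{i\ne j}|\langle v,z_j-z_i\rangle|$ (maximum over $v\in\mathbb{R}^n$) and $\kappa(Z)=\min_{1\le j\le s}\rho(Z,j)$; these are positive since the points are distinct. *)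

theory Defs
  imports
    "HOL-Analysis.Analysis"
    "Jordan_Normal_Form.Char_Poly"
begin

text \<open>
  Points of \<open>\<real>\<^sup>n\<close> are elements of \<^typ>\<open>real ^ 'n\<close>, so \<open>n = CARD('n)\<close>. A set of \<open>s\<close> points is
  given by an enumeration \<open>z 0, \<dots>, z (s - 1)\<close>; matrices are those of \<open>Jordan_Normal_Form\<close>, with
  rows and columns numbered from \<open>0\<close>.
\<close>

definition multi_indices :: "nat \<Rightarrow> ('n::finite \<Rightarrow> nat) set" where
  "multi_indices N = {\<alpha>. (\<Sum>l\<in>UNIV. \<alpha> l) \<le> N}"

definition monomial :: "('n::finite \<Rightarrow> nat) \<Rightarrow> real ^ 'n \<Rightarrow> real" where
  "monomial \<alpha> x = (\<Prod>l\<in>UNIV. vec_nth x l ^ \<alpha> l)"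

definition num_monomials :: "nat \<Rightarrow> nat \<Rightarrow> nat" where
  "num_monomials n N = (N + n) choose N"

text \<open>The ordering of the multi-indices is the enumeration \<open>e 0, \<dots>, e (\<nu> - 1)\<close>.\<close>

definition vandermonde_mat ::
  "nat \<Rightarrow> (nat \<Rightarrow> 'n::finite \<Rightarrow> nat) \<Rightarrow> nat \<Rightarrow> (nat \<Rightarrow> real ^ 'n) \<Rightarrow> real mat" where
  "vandermonde_mat N e s z =
     mat s (num_monomials CARD('n) N) (\<lambda>(i, k). monomial (e k) (z i))"

text \<open>
  The singular values of an \<open>m \<times> n\<close> matrix \<open>A\<close> are the square roots of the eigenvalues,
  counted with algebraic multiplicity, of the smaller of the two Gram matrices \<open>A A\<^sup>T\<close> and
  \<open>A\<^sup>T A\<close>, so that there are exactly \<open>min m n\<close> of them. The Gram matrix is real symmetric and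
  positive semidefinite, hence all complex roots of its characteristic polynomial are real and
  nonnegative.
\<close>

definition gram_mat :: "real mat \<Rightarrow> real mat" where
  "gram_mat A = (if dim_row A \<le> dim_col A then A * transpose_mat A else transpose_mat A * A)"

definition singular_values :: "real mat \<Rightarrow> real multiset" where
  "singular_values A = image_mset sqrt (proots (char_poly (gram_mat A)))"

text \<open>The \<open>k\<close>-th largest singular value, where \<open>1 \<le> k \<le> min m n\<close>.\<close>

definition singular_value :: "nat \<Rightarrow> real mat \<Rightarrow> real" where
  "singular_value k A = rev (sorted_list_of_multiset (singular_values A)) ! (k - 1)"

text \<open>
  The supremum is a maximum: a continuous function on the compact unit sphere. The minimum is over
  a nonempty set when \<open>s \<ge> 2\<close>.
\<close>

definition proj_sep :: "nat \<Rightarrow> (nat \<Rightarrow> real ^ 'n::finite) \<Rightarrow> nat \<Rightarrow> real" where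
  "proj_sep s z j =
     (SUP v\<in>sphere 0 1. MIN i\<in>{..<s} - {j}. \<bar>inner v (z j - z i)\<bar>)"

definition min_proj_sep :: "nat \<Rightarrow> (nat \<Rightarrow> real ^ 'n::finite) \<Rightarrow> real" where
  "min_proj_sep s z = (MIN j\<in>{..<s}. proj_sep s z j)"

lemma card_multi_indices:
  "card (multi_indices N :: ('n::finite \<Rightarrow> nat) set) = num_monomials CARD('n) N"
proof -
  obtain xs :: "'n list" where xs: "set xs = UNIV" "distinct xs"
    using finite_distinct_list[OF finite] by blast
  have len: "length xs = CARD('n)"
    using xs distinct_card by fastforce
  define L where "L = {l::nat list. length l = Suc CARD('n) \<and> sum_list l = N}"
  define h where "h = (\<lambda>\<alpha>::'n \<Rightarrow> nat. (N - (\<Sum>l\<in>UNIV. \<alpha> l)) # map \<alpha> xs)"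
  have sum_xs: "sum_list (map \<alpha> xs) = (\<Sum>l\<in>UNIV. \<alpha> l)" for \<alpha> :: "'n \<Rightarrow> nat"
    using xs by (metis sum_list_distinct_conv_sum_set)
  have "bij_betw h (multi_indices N) L"
    unfolding bij_betw_def
  proof
    show "inj_on h (multi_indices N)"
      by (rule inj_onI) (use xs in \<open>auto simp: h_def fun_eq_iff\<close>)
    show "h ` multi_indices N = L"
    proof
      show "h ` multi_indices N \<subseteq> L"
        by (auto simp: h_def L_def multi_indices_def len sum_xs)
      show "L \<subseteq> h ` multi_indices N"
      proof
        fix l assume l: "l \<in> L"
        then obtain a t where t: "l = a # t" "length t = length xs" "a + sum_list t = N"
          by (cases l) (auto simp: L_def len)
        define \<alpha> where "\<alpha> = the \<circ> map_of (zip xs t)"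
        have m: "map \<alpha> xs = t"
          using t xs by (auto intro!: nth_equalityI simp: \<alpha>_def map_of_zip_nth)
        have "\<alpha> \<in> multi_indices N" "h \<alpha> = l"
          using t m sum_xs[of \<alpha>] by (auto simp: h_def multi_indices_def)
        then show "l \<in> h ` multi_indices N" by blast
      qed
    qed
  qed
  then have "card (multi_indices N :: ('n \<Rightarrow> nat) set) = card L"
    by (rule bij_betw_same_card)
  also have "\<dots> = num_monomials CARD('n) N"
    unfolding L_def card_length_sum_list num_monomials_def by simp
  finally show ?thesis .
qed

end

theory Submission
  imports Defs
begin

text \<open>
  For each \<open>j\<close> choose a unit vector \<open>v\<close> attaining the projection separation of \<open>z j\<close>. The product of
  the affine forms \<open>x \<mapsto> \<langle>v, x - z i\<rangle>\<close> over \<open>i \<noteq> j\<close> has degree \<open>s - 1 \<le> N\<close>, vanishes at all points but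
  \<open>z j\<close>, where its absolute value is at least \<open>\<kappa>\<^sup>s\<^sup>-\<^sup>1\<close>, and its coefficients have absolute
  sum at most \<open>(2\<surd>n)\<^sup>s\<^sup>-\<^sup>1\<close>. Pairing its coefficient vector with \<open>V\<^sup>T u\<close> therefore gives
  \<open>\<kappa>\<^sup>s\<^sup>-\<^sup>1 \<bar>u j\<bar> \<le> (2\<surd>n)\<^sup>s\<^sup>-\<^sup>1 \<parallel>V\<^sup>T u\<parallel>\<close>, and summing the squares over \<open>j\<close> bounds \<open>\<parallel>V\<^sup>T u\<parallel> / \<parallel>u\<parallel>\<close> from
  below.
\<close>

section \<open>The smallest singular value\<close>

text \<open>The Hermitian form \<open>S\<close> of the symmetric \<open>G\<close> at the eigenvector
  equals \<open>a\<close> times the squared norm \<open>T\<close>, and it is its own conjugate. As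
  \<open>T > 0\<close>, the quotient \<open>a\<close> is real.\<close>

lemma symmetric_eigenvalue_real:
  fixes G :: "nat \<Rightarrow> nat \<Rightarrow> real" and x :: "nat \<Rightarrow> complex"
  assumes sym: "\<And>i j. i < n \<Longrightarrow> j < n \<Longrightarrow> G i j = G j i"
    and eig: "\<And>i. i < n \<Longrightarrow> (\<Sum>j<n. of_real (G i j) * x j) = a * x i"
    and k: "k < n" "x k \<noteq> 0"
  shows "a \<in> \<real>"
proof -
  define S where "S = (\<Sum>i<n. cnj (x i) * (\<Sum>j<n. of_real (G i j) * x j))"
  define T where "T = (\<Sum>i<n. (cmod (x i))\<^sup>2)"
  have "S = (\<Sum>i<n. cnj (x i) * (a * x i))"
    unfolding S_def using eig by (intro sum.cong) auto
  also have "\<dots> = (\<Sum>i<n. a * of_real ((cmod (x i))\<^sup>2))"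
    by (intro sum.cong refl) (simp add: complex_norm_square mult_ac del: of_real_power)
  also have "\<dots> = a * of_real T"
    by (simp add: T_def sum_distrib_left)
  finally have S: "S = a * of_real T" .
  \<comment> \<open>Conjugation exchanges the roles of the two summation indices; symmetry of
    \<open>G\<close> exchanges them back.\<close>
  have "cnj S = (\<Sum>i<n. \<Sum>j<n. x i * (of_real (G i j) * cnj (x j)))"
    by (simp add: S_def sum_distrib_left)
  also have "\<dots> = (\<Sum>j<n. \<Sum>i<n. x i * (of_real (G i j) * cnj (x j)))"
    by (rule sum.swap)
  also have "\<dots> = S"
    unfolding S_def sum_distrib_left
    by (intro sum.cong refl) (simp add: sym mult_ac)
  finally have "S \<in> \<real>"
    by (simp add: Reals_cnj_iff)
  moreover have "T > 0"
    unfolding T_def using k by (intro sum_pos2[of _ k]) auto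
  ultimately show ?thesis
    using S by (metis Reals_divide Reals_of_real less_irrefl nonzero_mult_div_cancel_right of_real_eq_0_iff)
qed

text \<open>Over the complex numbers the characteristic polynomial splits into \<open>n\<close>
  linear factors, and symmetry makes every root real. Hence the real roots alone already number
  \<open>n\<close>, which guarantees that the index used by \<open>singular_value\<close> is in
  range.\<close>

lemma size_proots_char_poly_symmetric:
  fixes A :: "real mat"
  assumes A: "A \<in> carrier_mat n n" and sym: "transpose_mat A = A"
  shows "size (proots (char_poly A)) = n"
proof -
  interpret of_real_poly_hom: map_poly_inj_idom_hom complex_of_real ..
  let ?C = "map_mat complex_of_real A"
  have C: "?C \<in> carrier_mat n n" using A by simp
  obtain as where as: "char_poly ?C = (\<Prod>a\<leftarrow>as. [:- a, 1:])" and len: "length as = n"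
    using char_poly_factorized[OF C] by blast
  have real: "a \<in> \<real>" if "a \<in> set as" for a
  proof -
    have "poly (char_poly ?C) a = 0"
      using that unfolding as by (auto simp: poly_prod_list prod_list_zero_iff)
    then obtain v where v: "v \<in> carrier_vec n" "v \<noteq> 0\<^sub>v n" "?C *\<^sub>v v = a \<cdot>\<^sub>v v"
      using C A by (auto simp: eigenvalue_root_char_poly[OF C, symmetric] eigenvalue_def eigenvector_def)
    obtain k where k: "k < n" "vec_index v k \<noteq> 0"
      using v by (metis carrier_vecD eq_vecI index_zero_vec)
    show ?thesis
    proof (rule symmetric_eigenvalue_real)
      show "A $$ (i, j) = A $$ (j, i)" if "i < n" "j < n" for i j
        using sym that A by (metis carrier_matD index_transpose_mat(1))
      show "(\<Sum>j<n. of_real (A $$ (i, j)) * vec_index v j) = a * vec_index v i" if "i < n" for i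
      proof -
        have "vec_index (?C *\<^sub>v v) i = (\<Sum>j<n. of_real (A $$ (i, j)) * vec_index v j)"
          using that A v(1) by (simp add: scalar_prod_def atLeast0LessThan)
        then show ?thesis using that v(1) unfolding v(3) by simp
      qed
    qed (use k in auto)
  qed
  have "map complex_of_real (map Re as) = as"
    using real by (simp add: map_idI)
  then have "char_poly ?C = (\<Prod>a\<leftarrow>map Re as. [:- of_real a, 1:])"
    using as by (metis (no_types, lifting) comp_def map_eq_conv map_map)
  also have "(\<Prod>a\<leftarrow>bs. [:- of_real a, 1:]) = map_poly complex_of_real (\<Prod>a\<leftarrow>bs. [:- a, 1:])" for bs
    by (induction bs) (simp_all add: of_real_poly_hom.hom_mult del: mult_pCons_left)
  \<comment> \<open>Both sides are images of real polynomials, so injectivity of the embedding of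
    coefficients turns the complex factorisation into a real one.\<close>
  finally have "map_poly complex_of_real (char_poly A) = map_poly of_real (\<Prod>a\<leftarrow>map Re as. [:- a, 1:])"
    by (simp add: of_real_hom.char_poly_hom[OF A])
  then have eq: "char_poly A = (\<Prod>a\<leftarrow>map Re as. [:- a, 1:])"
    by (simp only: of_real_poly_hom.eq_iff)
  have "size (proots (\<Prod>a\<leftarrow>bs. [:- a, 1:])) = length bs" for bs :: "real list"
  proof (induction bs)
    case (Cons b bs)
    have "(\<Prod>a\<leftarrow>bs. [:- a, 1:]) \<noteq> 0"
      by (auto simp: prod_list_zero_iff)
    with Cons show ?case
      by (simp add: proots_mult del: mult_pCons_left)
  qed simp
  then show ?thesis
    unfolding eq by (simp add: len del: map_map)
qed

lemma gram_mat_scalar_prod: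
  fixes A :: "real mat"
  assumes "A \<in> carrier_mat m n" "u \<in> carrier_vec m"
  shows "scalar_prod u ((A * transpose_mat A) *\<^sub>v u)
    = scalar_prod (transpose_mat A *\<^sub>v u) (transpose_mat A *\<^sub>v u)"
proof -
  let ?w = "transpose_mat A *\<^sub>v u"
  have w: "?w \<in> carrier_vec n" using assms by simp
  have "(A * transpose_mat A) *\<^sub>v u = A *\<^sub>v ?w"
    using assms by (intro assoc_mult_mat_vec) auto
  also have "scalar_prod u \<dots> = scalar_prod ?w ?w"
    using transpose_vec_mult_scalar[OF assms(1) w assms(2)] by simp
  finally show ?thesis .
qed

text \<open>The singular value is \<open>sqrt k\<close> for some eigenvalue \<open>k\<close> of the
  Gram matrix. At an eigenvector \<open>u\<close> the Rayleigh quotient is exactly \<open>k\<close>,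
  so the assumed quadratic bound gives \<open>c^2 \<le> k\<close>.\<close>

lemma singular_value_ge:
  fixes A :: "real mat"
  assumes A: "A \<in> carrier_mat m n" and mn: "m \<le> n" "0 < m"
    and c: "\<And>u. u \<in> carrier_vec m \<Longrightarrow>
      c\<^sup>2 * scalar_prod u u \<le> scalar_prod (transpose_mat A *\<^sub>v u) (transpose_mat A *\<^sub>v u)"
  shows "c \<le> singular_value m A"
proof -
  let ?G = "A * transpose_mat A"
  have G: "?G \<in> carrier_mat m m" using A by simp
  have "transpose_mat ?G = ?G"
    using A by (simp add: transpose_mult[of A m n "transpose_mat A" m])
  then have size: "size (proots (char_poly ?G)) = m"
    using size_proots_char_poly_symmetric[OF G] by blast
  have sv: "singular_values A = image_mset sqrt (proots (char_poly ?G))"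
    using A mn by (simp add: singular_values_def gram_mat_def)
  let ?l = "rev (sorted_list_of_multiset (singular_values A))"
  have "length ?l = m"
    using size unfolding sv
    by (metis length_rev mset_sorted_list_of_multiset size_image_mset size_mset)
  then have "?l ! (m - 1) \<in> set ?l"
    using mn by (intro nth_mem) simp
  then have "singular_value m A \<in># singular_values A"
    unfolding singular_value_def by simp
  then obtain k where k: "k \<in># proots (char_poly ?G)" "singular_value m A = sqrt k"
    unfolding sv by auto
  \<comment> \<open>\<open>proots 0\<close> is empty by convention, whereas here there are
    \<open>m > 0\<close> roots.\<close>
  have "char_poly ?G \<noteq> 0"
    using size mn by auto
  with k have "poly (char_poly ?G) k = 0" by simp
  then obtain u where u: "u \<in> carrier_vec m" "u \<noteq> 0\<^sub>v m" "?G *\<^sub>v u = k \<cdot>\<^sub>v u"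
    using G A by (auto simp: eigenvalue_root_char_poly[OF G, symmetric] eigenvalue_def eigenvector_def)
  obtain i where i: "i < m" "vec_index u i \<noteq> 0"
    using u by (metis carrier_vecD eq_vecI index_zero_vec)
  have "scalar_prod u u = (\<Sum>i<m. (vec_index u i)\<^sup>2)"
    using u by (simp add: scalar_prod_def atLeast0LessThan power2_eq_square)
  also have "\<dots> > 0"
    using i by (intro sum_pos2[of _ i]) auto
  finally have pos: "scalar_prod u u > 0" .
  have "c\<^sup>2 * scalar_prod u u \<le> k * scalar_prod u u"
    using c[OF u(1)] gram_mat_scalar_prod[OF A u(1)] u by simp
  then have "c\<^sup>2 \<le> k" using pos by simp
  then show ?thesis
    using k real_le_rsqrt by simp
qed

section \<open>Coefficient bounds for polynomials\<close>

text \<open>This bounds the l1 norm of the coefficients. That norm suits products of affine forms: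
  each further factor multiplies the bound by a constant. Polynomials are treated as functions, and
  any one representation by monomials may serve as witness.\<close>

definition coeff_bounded :: "nat \<Rightarrow> real \<Rightarrow> (real ^ 'n::finite \<Rightarrow> real) \<Rightarrow> bool" where
  "coeff_bounded d B f \<longleftrightarrow> (\<exists>c. (\<forall>x. f x = (\<Sum>\<alpha>\<in>multi_indices d. c \<alpha> * monomial \<alpha> x)) \<and>
     (\<Sum>\<alpha>\<in>multi_indices d. \<bar>c \<alpha>\<bar>) \<le> B)"

lemma finite_multi_indices: "finite (multi_indices d :: ('n::finite \<Rightarrow> nat) set)"
  by (rule card_ge_0_finite) (simp add: card_multi_indices num_monomials_def)

lemma multi_indices_mono: "d \<le> d' \<Longrightarrow> multi_indices d \<subseteq> multi_indices d'"
  by (auto simp: multi_indices_def)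

text \<open>Padding with zero coefficients. It lets terms of different degree be added, and later
  lifts degree \<open>s - 1\<close> to \<open>N\<close>.\<close>

lemma coeff_bounded_mono:
  assumes "coeff_bounded d B f" "d \<le> d'" "B \<le> B'"
  shows "coeff_bounded d' B' f"
proof -
  obtain c where c: "\<And>x. f x = (\<Sum>\<alpha>\<in>multi_indices d. c \<alpha> * monomial \<alpha> x)"
    "(\<Sum>\<alpha>\<in>multi_indices d. \<bar>c \<alpha>\<bar>) \<le> B"
    using assms unfolding coeff_bounded_def by blast
  define c' where "c' \<alpha> = (if \<alpha> \<in> multi_indices d then c \<alpha> else 0)" for \<alpha>
  note sub = multi_indices_mono[OF assms(2)]
  have "(\<Sum>\<alpha>\<in>multi_indices d'. c' \<alpha> * monomial \<alpha> x) = f x" for x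
    unfolding c c'_def
    by (rule sum.mono_neutral_cong_right) (use sub finite_multi_indices in auto)
  moreover have "(\<Sum>\<alpha>\<in>multi_indices d'. \<bar>c' \<alpha>\<bar>) = (\<Sum>\<alpha>\<in>multi_indices d. \<bar>c \<alpha>\<bar>)"
    unfolding c'_def
    by (rule sum.mono_neutral_cong_right) (use sub finite_multi_indices in auto)
  ultimately show ?thesis
    unfolding coeff_bounded_def using c assms(3) by (intro exI[of _ c']) auto
qed

lemma coeff_bounded_one: "coeff_bounded 0 1 (\<lambda>_::real ^ 'n::finite. 1)"
proof -
  have "multi_indices 0 = {\<lambda>_::'n. 0}"
    by (auto simp: multi_indices_def)
  then show ?thesis
    unfolding coeff_bounded_def by (intro exI[of _ "\<lambda>_. 1"]) (simp add: monomial_def)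
qed

lemma coeff_bounded_zero: "coeff_bounded d 0 (\<lambda>_. 0)"
  unfolding coeff_bounded_def by (intro exI[of _ "\<lambda>_. 0"]) simp

lemma coeff_bounded_add:
  assumes "coeff_bounded d A f" "coeff_bounded d B g"
  shows "coeff_bounded d (A + B) (\<lambda>x. f x + g x)"
proof -
  obtain a b where a: "\<forall>x. f x = (\<Sum>\<alpha>\<in>multi_indices d. a \<alpha> * monomial \<alpha> x)"
      "(\<Sum>\<alpha>\<in>multi_indices d. \<bar>a \<alpha>\<bar>) \<le> A"
    and b: "\<forall>x. g x = (\<Sum>\<alpha>\<in>multi_indices d. b \<alpha> * monomial \<alpha> x)"
      "(\<Sum>\<alpha>\<in>multi_indices d. \<bar>b \<alpha>\<bar>) \<le> B"
    using assms unfolding coeff_bounded_def by blast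
  have "(\<Sum>\<alpha>\<in>multi_indices d. \<bar>a \<alpha> + b \<alpha>\<bar>) \<le> (\<Sum>\<alpha>\<in>multi_indices d. \<bar>a \<alpha>\<bar> + \<bar>b \<alpha>\<bar>)"
    by (intro sum_mono abs_triangle_ineq)
  then show ?thesis
    unfolding coeff_bounded_def using a b
    by (intro exI[of _ "\<lambda>\<alpha>. a \<alpha> + b \<alpha>"]) (auto simp: sum.distrib distrib_right)
qed

lemma coeff_bounded_cmult:
  assumes "coeff_bounded d B f"
  shows "coeff_bounded d (\<bar>r\<bar> * B) (\<lambda>x. r * f x)"
proof -
  obtain c where c: "\<forall>x. f x = (\<Sum>\<alpha>\<in>multi_indices d. c \<alpha> * monomial \<alpha> x)"
    "(\<Sum>\<alpha>\<in>multi_indices d. \<bar>c \<alpha>\<bar>) \<le> B"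
    using assms unfolding coeff_bounded_def by blast
  then show ?thesis
    unfolding coeff_bounded_def
    by (intro exI[of _ "\<lambda>\<alpha>. r * c \<alpha>"])
      (auto simp: sum_distrib_left[symmetric] abs_mult mult.assoc intro!: mult_left_mono)
qed

lemma coeff_bounded_sum:
  assumes "finite I" "\<And>i. i \<in> I \<Longrightarrow> coeff_bounded d (B i) (f i)"
  shows "coeff_bounded d (\<Sum>i\<in>I. B i) (\<lambda>x. \<Sum>i\<in>I. f i x)"
  using assms
  by (induction I rule: finite_induct) (auto intro: coeff_bounded_zero coeff_bounded_add)

text \<open>Multiplication by a coordinate shifts exponents injectively. Coefficients are only
  relabelled, so their absolute sum does not grow.\<close>

lemma coeff_bounded_mult_component:
  fixes f :: "real ^ 'n::finite \<Rightarrow> real"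
  assumes "coeff_bounded d B f"
  shows "coeff_bounded (Suc d) B (\<lambda>x. vec_nth x l * f x)"
proof -
  obtain c where c: "\<And>x. f x = (\<Sum>\<alpha>\<in>multi_indices d. c \<alpha> * monomial \<alpha> x)"
    "(\<Sum>\<alpha>\<in>multi_indices d. \<bar>c \<alpha>\<bar>) \<le> B"
    using assms unfolding coeff_bounded_def by blast
  define h where "h \<alpha> = \<alpha>(l := Suc (\<alpha> l))" for \<alpha> :: "'n \<Rightarrow> nat"
  have inj: "inj_on h X" for X
    by (rule inj_onI) (metis fun_upd_eqD fun_upd_triv fun_upd_upd h_def nat.inject)
  \<comment> \<open>The coefficients are transported along the shift \<open>h\<close>; the value is
    zero at monomials of degree at most \<open>Suc d\<close> that do not contain the variable
    \<open>l\<close>.\<close>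
  define c' where "c' \<beta> = (if \<beta> \<in> h ` multi_indices d then c (the_inv_into (multi_indices d) h \<beta>) else 0)" for \<beta>
  have c': "c' (h \<alpha>) = c \<alpha>" if "\<alpha> \<in> multi_indices d" for \<alpha>
    using that inj by (simp add: c'_def the_inv_into_f_f)
  have "(\<Sum>i\<in>UNIV. h \<alpha> i) = Suc (\<Sum>i\<in>UNIV. \<alpha> i)" for \<alpha>
    by (simp add: h_def sum.remove[of UNIV l] cong: sum.cong_simp)
  then have sub: "h ` multi_indices d \<subseteq> multi_indices (Suc d)"
    by (auto simp: multi_indices_def)
  have mono: "monomial (h \<alpha>) x = vec_nth x l * monomial \<alpha> x" for \<alpha> x
    by (simp add: monomial_def h_def prod.remove[of UNIV l] cong: prod.cong_simp)
  \<comment> \<open>A general \<open>F\<close> vanishing at coefficient zero covers both uses: the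
    value of the polynomial and the absolute sum of its coefficients.\<close>
  have red: "(\<Sum>\<beta>\<in>multi_indices (Suc d). F (c' \<beta>) \<beta>) = (\<Sum>\<alpha>\<in>multi_indices d. F (c \<alpha>) (h \<alpha>))"
    if "\<And>\<beta>. F 0 \<beta> = 0" for F :: "real \<Rightarrow> _ \<Rightarrow> real"
  proof -
    have "(\<Sum>\<beta>\<in>multi_indices (Suc d). F (c' \<beta>) \<beta>) = (\<Sum>\<beta>\<in>h ` multi_indices d. F (c' \<beta>) \<beta>)"
      by (rule sum.mono_neutral_right) (use sub finite_multi_indices that in \<open>auto simp: c'_def\<close>)
    also have "\<dots> = (\<Sum>\<alpha>\<in>multi_indices d. F (c \<alpha>) (h \<alpha>))"
      by (subst sum.reindex[OF inj]) (auto simp: c' intro!: sum.cong)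
    finally show ?thesis .
  qed
  have "vec_nth x l * f x = (\<Sum>\<beta>\<in>multi_indices (Suc d). c' \<beta> * monomial \<beta> x)" for x
    using red[of "\<lambda>r \<beta>. r * monomial \<beta> x"] by (simp add: mono c sum_distrib_left mult_ac)
  moreover have "(\<Sum>\<beta>\<in>multi_indices (Suc d). \<bar>c' \<beta>\<bar>) = (\<Sum>\<alpha>\<in>multi_indices d. \<bar>c \<alpha>\<bar>)"
    using red[of "\<lambda>r \<beta>. \<bar>r\<bar>"] by simp
  ultimately show ?thesis
    unfolding coeff_bounded_def using c by (intro exI[of _ c']) auto
qed

lemma coeff_bounded_nonneg: "coeff_bounded d B f \<Longrightarrow> B \<ge> 0"
  unfolding coeff_bounded_def by (meson abs_ge_zero order_trans sum_nonneg)

text \<open>The linear part of the affine form contributes the l1 norm of \<open>v\<close>, at most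
  \<open>sqrt n\<close> by Cauchy-Schwarz with \<open>n = CARD('n)\<close>. The constant term
  contributes \<open>\<bar>inner v z\<bar> \<le> 1 \<le> sqrt n\<close>. Together they give the
  factor \<open>2 * sqrt n\<close>.\<close>

lemma coeff_bounded_mult_affine:
  fixes f :: "real ^ 'n::finite \<Rightarrow> real"
  assumes f: "coeff_bounded d B f" and v: "norm v = 1" and z: "norm z \<le> 1"
  shows "coeff_bounded (Suc d) (2 * sqrt CARD('n) * B) (\<lambda>x. inner v (x - z) * f x)"
proof -
  have eq: "inner v (x - z) * f x
      = (\<Sum>l\<in>UNIV. vec_nth v l * (vec_nth x l * f x)) + (- inner v z) * f x" for x
    by (simp add: inner_diff_right inner_vec_def[of v x] sum_distrib_left algebra_simps)
  have "coeff_bounded (Suc d) ((\<Sum>l\<in>UNIV. \<bar>vec_nth v l\<bar> * B) + \<bar>- inner v z\<bar> * B)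
      (\<lambda>x. inner v (x - z) * f x)"
    unfolding eq
    by (intro coeff_bounded_add coeff_bounded_sum coeff_bounded_cmult
        coeff_bounded_mult_component coeff_bounded_mono[OF f]) (use f in auto)
  moreover have "(\<Sum>l\<in>UNIV. \<bar>vec_nth v l\<bar> * B) + \<bar>- inner v z\<bar> * B \<le> 2 * sqrt CARD('n) * B"
  proof -
    have "(\<Sum>l\<in>UNIV. \<bar>vec_nth v l\<bar> * \<bar>1\<bar>) \<le> L2_set (vec_nth v) UNIV * L2_set (\<lambda>_. 1) (UNIV :: 'n set)"
      by (rule L2_set_mult_ineq)
    also have "\<dots> = sqrt CARD('n)"
      using v by (simp add: norm_vec_def L2_set_def)
    finally have "(\<Sum>l\<in>UNIV. \<bar>vec_nth v l\<bar>) \<le> sqrt CARD('n)" by simp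
    moreover have "\<bar>inner v z\<bar> \<le> 1"
      using Cauchy_Schwarz_ineq2[of v z] v z by simp
    moreover have "1 \<le> sqrt CARD('n)"
      by (simp add: Suc_leI)
    ultimately have "(\<Sum>l\<in>UNIV. \<bar>vec_nth v l\<bar>) + \<bar>- inner v z\<bar> \<le> 2 * sqrt CARD('n)"
      by linarith
    then show ?thesis
      using mult_right_mono[OF _ coeff_bounded_nonneg[OF f]]
      by (fastforce simp: sum_distrib_right distrib_right)
  qed
  ultimately show ?thesis
    using coeff_bounded_mono by blast
qed

lemma coeff_bounded_prod_affine:
  fixes z :: "'i \<Rightarrow> real ^ 'n::finite"
  assumes "finite I" "norm v = 1" "\<And>i. i \<in> I \<Longrightarrow> norm (z i) \<le> 1"
  shows "coeff_bounded (card I) ((2 * sqrt CARD('n)) ^ card I) (\<lambda>x. \<Prod>i\<in>I. inner v (x - z i))"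
  using assms(1,3)
proof (induction I rule: finite_induct)
  case empty
  then show ?case by (simp add: coeff_bounded_one)
next
  case (insert i I)
  then show ?case
    using coeff_bounded_mult_affine[OF _ assms(2), of "card I" _ _ "z i"] by simp
qed

section \<open>Projection separations\<close>

lemma continuous_on_MIN:
  fixes f :: "'i \<Rightarrow> 'a::topological_space \<Rightarrow> real"
  assumes "finite I" "I \<noteq> {}" "\<And>i. i \<in> I \<Longrightarrow> continuous_on S (f i)"
  shows "continuous_on S (\<lambda>x. MIN i\<in>I. f i x)"
  using assms
  by (induction I rule: finite_ne_induct) (auto intro: continuous_on_min)

lemma proj_sep_attained:
  fixes z :: "nat \<Rightarrow> real ^ 'n::finite"
  assumes "{..<s} - {j} \<noteq> {}"
  obtains v where "norm v = 1" "proj_sep s z j = (MIN i\<in>{..<s} - {j}. \<bar>inner v (z j - z i)\<bar>)"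
proof -
  let ?f = "\<lambda>v. MIN i\<in>{..<s} - {j}. \<bar>inner v (z j - z i)\<bar>"
  have "continuous_on (sphere 0 1) ?f"
    using assms by (intro continuous_on_MIN continuous_intros) auto
  then obtain v where v: "v \<in> sphere 0 1" "\<And>y. y \<in> sphere 0 1 \<Longrightarrow> ?f y \<le> ?f v"
    using continuous_attains_sup[of "sphere 0 1" ?f] by fastforce
  have "proj_sep s z j = ?f v"
    unfolding proj_sep_def using v by (intro cSup_eq_maximum) auto
  then show ?thesis using that v by simp
qed

lemma other_points_nonempty:
  assumes "s \<ge> 2"
  shows "{..<s} - {j::nat} \<noteq> {}"
proof -
  have "(if j = 0 then 1 else 0) \<in> {..<s} - {j}"
    using assms by auto
  then show ?thesis by blast
qed

text \<open>Supplies the common direction \<open>v\<close> of all affine forms attached to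
  \<open>z j\<close>, namely a maximiser for \<open>proj_sep s z j\<close>.\<close>

lemma min_proj_sep_direction:
  fixes z :: "nat \<Rightarrow> real ^ 'n::finite"
  assumes "s \<ge> 2" "j < s"
  obtains v where "norm v = 1"
    "\<And>i. i < s \<Longrightarrow> i \<noteq> j \<Longrightarrow> min_proj_sep s z \<le> \<bar>inner v (z j - z i)\<bar>"
proof -
  note ne = other_points_nonempty[OF assms(1), of j]
  obtain v where v: "norm v = 1" "proj_sep s z j = (MIN i\<in>{..<s} - {j}. \<bar>inner v (z j - z i)\<bar>)"
    using proj_sep_attained[OF ne] by blast
  have "min_proj_sep s z \<le> proj_sep s z j"
    unfolding min_proj_sep_def using assms by (intro Min_le) auto
  moreover have "proj_sep s z j \<le> \<bar>inner v (z j - z i)\<bar>" if "i < s" "i \<noteq> j" for i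
    unfolding v(2) using that by (intro Min_le) auto
  ultimately show ?thesis using that v(1) by (meson order_trans)
qed

text \<open>The sign is what permits multiplying the lower bounds factor by factor and squaring the
  resulting inequality.\<close>

lemma min_proj_sep_nonneg:
  fixes z :: "nat \<Rightarrow> real ^ 'n::finite"
  assumes "s \<ge> 2"
  shows "min_proj_sep s z \<ge> 0"
proof -
  have "proj_sep s z j \<ge> 0" for j
  proof -
    note ne = other_points_nonempty[OF assms, of j]
    then obtain v where "proj_sep s z j = (MIN i\<in>{..<s} - {j}. \<bar>inner v (z j - z i)\<bar>)"
      using proj_sep_attained[OF ne] by blast
    then show ?thesis using ne by (simp add: Min_ge_iff)
  qed
  then show ?thesis
    unfolding min_proj_sep_def using assms by (subst Min_ge_iff) (auto simp: lessThan_empty_iff)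
qed

section \<open>Estimate of one coordinate and assembly of the bound\<close>

lemma moment_bound:
  fixes z :: "nat \<Rightarrow> real ^ 'n::finite" and u :: "nat \<Rightarrow> real"
  assumes s: "s \<ge> 2" and z: "\<And>i. i < s \<Longrightarrow> norm (z i) \<le> 1" and N: "s - 1 \<le> N" and j: "j < s"
  shows "min_proj_sep s z ^ (s - 1) * \<bar>u j\<bar> \<le> (2 * sqrt CARD('n)) ^ (s - 1) *
    sqrt (\<Sum>\<alpha>\<in>multi_indices N. (\<Sum>i<s. u i * monomial \<alpha> (z i))\<^sup>2)"
proof -
  \<comment> \<open>\<open>W\<close> lists the moments of the signed measure with mass
    \<open>u i\<close> at \<open>z i\<close>; in matrix terms it is the transposed Vandermonde
    matrix applied to \<open>u\<close>.\<close>
  define W where "W \<alpha> = (\<Sum>i<s. u i * monomial \<alpha> (z i))" for \<alpha>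
  define R where "R = sqrt (\<Sum>\<alpha>\<in>multi_indices N. (W \<alpha>)\<^sup>2)"
  define I where "I = {..<s} - {j}"
  have I: "finite I" "card I = s - 1"
    using j by (auto simp: I_def)
  obtain v where v: "norm v = 1"
    "\<And>i. i < s \<Longrightarrow> i \<noteq> j \<Longrightarrow> min_proj_sep s z \<le> \<bar>inner v (z j - z i)\<bar>"
    using min_proj_sep_direction[OF s j] by blast
  \<comment> \<open>An unnormalised Lagrange polynomial for \<open>z j\<close>: integrating it
    against the measure isolates the mass \<open>u j\<close>, with the weight
    \<open>q (z j)\<close>.\<close>
  define q where "q x = (\<Prod>i\<in>I. inner v (x - z i))" for x
  have "coeff_bounded N ((2 * sqrt CARD('n)) ^ (s - 1)) q"
    using coeff_bounded_prod_affine[of I v z] coeff_bounded_mono[OF _ N] I v(1) z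
    unfolding q_def by (auto simp: I_def)
  then obtain c where c: "\<And>x. q x = (\<Sum>\<alpha>\<in>multi_indices N. c \<alpha> * monomial \<alpha> x)"
    "(\<Sum>\<alpha>\<in>multi_indices N. \<bar>c \<alpha>\<bar>) \<le> (2 * sqrt CARD('n)) ^ (s - 1)"
    unfolding coeff_bounded_def by blast
  have "(\<Prod>i\<in>I. min_proj_sep s z) \<le> (\<Prod>i\<in>I. \<bar>inner v (z j - z i)\<bar>)"
    using v(2) min_proj_sep_nonneg[OF s] by (intro prod_mono) (auto simp: I_def)
  then have "min_proj_sep s z ^ (s - 1) \<le> \<bar>q (z j)\<bar>"
    by (simp add: I q_def abs_prod)
  then have "min_proj_sep s z ^ (s - 1) * \<bar>u j\<bar> \<le> \<bar>u j * q (z j)\<bar>"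
    by (simp add: abs_mult mult.commute mult_left_mono)
  also have "u j * q (z j) = (\<Sum>i<s. u i * q (z i))"
  proof -
    have "q (z i) = 0" if "i < s" "i \<noteq> j" for i
      using that I unfolding q_def by (intro prod_zero bexI[of _ i]) (auto simp: I_def)
    then have "(\<Sum>i<s. u i * q (z i)) = (\<Sum>i\<in>{j}. u i * q (z i))"
      using j by (intro sum.mono_neutral_right) auto
    then show ?thesis by simp
  qed
  also have "\<dots> = (\<Sum>\<alpha>\<in>multi_indices N. c \<alpha> * W \<alpha>)"
    unfolding c W_def sum_distrib_left
    by (subst sum.swap) (simp add: mult_ac)
  \<comment> \<open>Hoelder's inequality for l1 against the sup norm; each moment is at most the
    Euclidean norm \<open>R\<close> because its square is one term of the sum.\<close>
  also have "\<bar>\<dots>\<bar> \<le> (\<Sum>\<alpha>\<in>multi_indices N. \<bar>c \<alpha>\<bar> * R)"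
  proof -
    have "\<bar>W \<alpha>\<bar> \<le> R" if "\<alpha> \<in> multi_indices N" for \<alpha>
      unfolding R_def
      by (intro real_le_rsqrt order_trans[OF eq_refl[OF power2_abs]]
          member_le_sum[OF that, of "\<lambda>\<alpha>. (W \<alpha>)\<^sup>2"] finite_multi_indices) simp
    then show ?thesis
      by (intro order_trans[OF sum_abs] sum_mono) (simp add: abs_mult mult_left_mono)
  qed
  also have "\<dots> \<le> (2 * sqrt CARD('n)) ^ (s - 1) * R"
    using c(2) unfolding sum_distrib_right[symmetric]
    by (intro mult_right_mono) (auto simp: R_def sum_nonneg)
  finally show ?thesis
    by (simp add: R_def W_def)
qed

text \<open>The binomial coefficient grows with \<open>n\<close> and equals \<open>N + 1\<close> at
  \<open>n = 1\<close>. With \<open>N \<ge> s - 1\<close> the Vandermonde matrix has at least as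
  many columns as rows, so \<open>gram_mat\<close> is the \<open>s\<close> by \<open>s\<close>
  product.\<close>

lemma num_monomials_ge:
  assumes "n > 0"
  shows "Suc N \<le> num_monomials n N"
proof -
  have "Suc N choose N \<le> (N + n) choose N"
    using assms by (intro binomial_right_mono) simp
  then show ?thesis by (simp add: num_monomials_def)
qed

theorem corollary3p2:
  fixes z :: "nat \<Rightarrow> real ^ 'n::finite"
    and e :: "nat \<Rightarrow> 'n \<Rightarrow> nat"
    and s N :: nat
  assumes "s \<ge> 2"
    and "inj_on z {..<s}"
    and "\<And>i. i < s \<Longrightarrow> z i \<in> cball 0 1"
    and "N \<ge> s - 1"
    and "bij_betw e {..<num_monomials CARD('n) N} (multi_indices N)"
  shows "singular_value s (vandermonde_mat N e s z) \<ge>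
    min_proj_sep s z ^ (s - 1) /
      ((4 * real CARD('n)) ^ (s - 1) * real s * sqrt (real s * real (num_monomials CARD('n) N)))"
proof -
  let ?V = "vandermonde_mat N e s z"
  define \<nu> where "\<nu> = num_monomials CARD('n) N"
  define K where "K = min_proj_sep s z ^ (s - 1)"
  define B where "B = (2 * sqrt CARD('n)) ^ (s - 1)"
  have \<nu>: "s \<le> \<nu>"
    using num_monomials_ge[of "CARD('n)" N] assms(1,4) by (simp add: \<nu>_def)
  have V: "?V \<in> carrier_mat s \<nu>"
    by (simp add: vandermonde_mat_def \<nu>_def)
  have K: "K \<ge> 0"
    unfolding K_def using min_proj_sep_nonneg[OF assms(1), of z] by simp
  have B: "B > 0"
    by (simp add: B_def)
  \<comment> \<open>A sharper bound comes first; its factor \<open>sqrt s\<close> arises from adding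
    the squared estimates of the \<open>s\<close> coordinates of \<open>u\<close>.\<close>
  have "K / (B * sqrt s) \<le> singular_value s ?V"
  proof (rule singular_value_ge[OF V \<nu>])
    fix u :: "real Matrix.vec"
    assume u: "u \<in> carrier_vec s"
    let ?w = "transpose_mat ?V *\<^sub>v u"
    define M where "M = (\<Sum>\<alpha>\<in>multi_indices N. (\<Sum>i<s. vec_index u i * monomial \<alpha> (z i))\<^sup>2)"
    have M: "M \<ge> 0" by (simp add: M_def sum_nonneg)
    have "scalar_prod ?w ?w = (\<Sum>k<\<nu>. (vec_index ?w k)\<^sup>2)"
      using V by (simp add: scalar_prod_def atLeast0LessThan power2_eq_square)
    also have "\<dots> = (\<Sum>k<\<nu>. (\<Sum>i<s. vec_index u i * monomial (e k) (z i))\<^sup>2)"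
      using u by (intro sum.cong)
        (auto simp: vandermonde_mat_def \<nu>_def scalar_prod_def atLeast0LessThan mult.commute)
    \<comment> \<open>The enumeration \<open>e\<close> turns the sum over columns into a sum over
      multi-indices.\<close>
    also have "\<dots> = M"
      unfolding M_def \<nu>_def using assms(5) by (rule sum.reindex_bij_betw)
    finally have w: "scalar_prod ?w ?w = M" .
    have "(K * vec_index u j)\<^sup>2 \<le> B\<^sup>2 * M" if "j < s" for j
    proof -
      have "K * \<bar>vec_index u j\<bar> \<le> B * sqrt M"
        unfolding K_def B_def M_def using assms that by (intro moment_bound) auto
      then have "(K * \<bar>vec_index u j\<bar>)\<^sup>2 \<le> (B * sqrt M)\<^sup>2"
        using K by (intro power_mono) auto
      then show ?thesis using M by (simp add: power_mult_distrib)
    qed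
    then have "(\<Sum>j<s. (K * vec_index u j)\<^sup>2) \<le> (\<Sum>j<s. B\<^sup>2 * M)"
      by (intro sum_mono) simp
    moreover have "K\<^sup>2 * scalar_prod u u = (\<Sum>j<s. (K * vec_index u j)\<^sup>2)"
      using u by (simp add: scalar_prod_def atLeast0LessThan power2_eq_square sum_distrib_left mult_ac)
    ultimately have "K\<^sup>2 * scalar_prod u u \<le> s * (B\<^sup>2 * M)"
      by simp
    then show "(K / (B * sqrt s))\<^sup>2 * scalar_prod u u \<le> scalar_prod ?w ?w"
      unfolding w using B assms(1) by (simp add: power_divide power_mult_distrib field_simps)
  qed (use assms in simp)
  \<comment> \<open>The stated denominator is larger: \<open>2 * sqrt n \<le> 4 * n\<close> for
    \<open>n \<ge> 1\<close>, and \<open>sqrt s \<le> s * sqrt (s * \<nu>)\<close>.\<close>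
  moreover have "K / ((4 * real CARD('n)) ^ (s - 1) * s * sqrt (s * \<nu>)) \<le> K / (B * sqrt s)"
  proof -
    have n: "1 \<le> real CARD('n)" by (simp add: Suc_leI)
    then have "sqrt CARD('n) \<le> real CARD('n)"
      using real_sqrt_le_iff[of "real CARD('n)" "(real CARD('n))\<^sup>2"] by (simp add: power2_eq_square)
    then have "B \<le> (4 * real CARD('n)) ^ (s - 1)"
      unfolding B_def using n by (intro power_mono) auto
    moreover have "sqrt s \<le> s * sqrt (s * \<nu>)"
    proof -
      have "1 * sqrt s \<le> s * sqrt (s * \<nu>)"
        using assms(1) \<nu> by (intro mult_mono) auto
      then show ?thesis by simp
    qed
    ultimately have "B * sqrt s \<le> (4 * real CARD('n)) ^ (s - 1) * (s * sqrt (s * \<nu>))"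
      using B by (intro mult_mono) auto
    then show ?thesis
      using K B assms(1) \<nu>
      by (intro divide_left_mono mult_pos_pos) (auto simp: mult.assoc)
  qed
  ultimately show ?thesis
    by (simp add: K_def \<nu>_def)
qed

end
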